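(* Let $G$ be a finite group and $H$ a normal subgroup of $G$. The observable algebra $\mathcal{A}_{(H,G)}$ (the fixed-point algebra of the field algebra $\mathcal{F}_H$ under the action of $D(H;G)$) is the unital $C^*$-subalgebra of $\mathcal{F}_H$ generated by $$\left\{v_h(x),\ w_g(l)\colon h\in H,\ g\in G,\ x\in\mathbb{Z},\ l\in\mathbb{Z}+\tfrac12\right\}.$$
   Context: Let $G$ be a finite group with unit $e$ and $H$ a normal subgroup of $G$. Write $\delta_{a,b}=1$ if $a=b$ and $0$ otherwise. **The Hopf $C^*$-algebra $D(H;G)$.** It is the crossed product of $C(H)$ (complex functions on $H$) with the group algebra $\mathbb{C}G$ with respect to the adjoint action. It has linear basis $(h,g)$, $h\in H$, $g\in G$, and structure maps $(h_1,g_1)(h_2,g_2)=\delta_{h_1g_1,g_1h_2}(h_1,g_1g_2)$, $\ \Delta(h,g)=\sum_{t\in H}(t,g)\otimes(t^{-1}h,g)$, $\ \varepsilon(h,g)=\delta_{h,e}$, $\ S(h,g)=(g^{-1}h^{-1}g,g^{-1})$, $\ (h,g)^*=(g^{-1}hg,g^{-1})$. **The field algebra $\mathcal{F}_H$.** The local field algebra $\mathcal{F}_{H,\mathrm{loc}}$ is the associative algebra over $\mathbb{C}$ with unit $I$ generated by $\{\delta_g(x),\rho_h(l)\colon g\in G,\ h\in H,\ x\in\mathbb{Z},\ l\in\mathbb{Z}+\frac12\}$ subject to the relations (for all $x,x'\in\mathbb{Z}$, $l,l'\in\mathbb{Z}+\frac12$, $h,h_1,h_2\in H$, $g,g_1,g_2\in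 G$): - $\sum_{g\in G}\delta_g(x)=I=\rho_e(l)$; - $\delta_{g_1}(x)\delta_{g_2}(x)=\delta_{g_1,g_2}\delta_{g_1}(x)$; - $\rho_{h_1}(l)\rho_{h_2}(l)=\rho_{h_1h_2}(l)$; - $\delta_{g_1}(x)\delta_{g_2}(x')=\delta_{g_2}(x')\delta_{g_1}(x)$; - $\rho_h(l)\delta_g(x)=\delta_{hg}(x)\rho_h(l)$ if $l<x$, and $\rho_h(l)\delta_g(x)=\delta_g(x)\rho_h(l)$ if $l>x$; - $\rho_{h_1}(l)\rho_{h_2}(l')=\rho_{h_2}(l')\rho_{h_2^{-1}h_1h_2}(l)$ if $l>l'$, and $\rho_{h_1}(l)\rho_{h_2}(l')=\rho_{h_1h_2h_1^{-1}}(l')\rho_{h_1}(l)$ if $l<l'$. It is a unital $*$-algebra with $\delta_g(x)^*=\delta_g(x)$ and $\rho_h(l)^*=\rho_{h^{-1}}(l)$. It is the increasing union of the finite-dimensional $C^*$-algebras generated by the $\delta_g(x),\rho_h(l)$ with $x,l$ in a finite interval, and $\mathcal{F}_H$ denotes the $C^*$-inductive limit of these, i.e. the $C^*$-completion of $\mathcal{F}_{H,\mathrm{loc}}$. **The action and the observable algebra.** $D(H;G)$ acts on $\mathcal{F}_H$, making it a $D(H;G)$-module algebra (i.e. $a(FF')=\sum_{(a)}a_{(1)}(F)\,a_{(2)}(F')$ and $a(I)=\varepsilon(a)I$). On generators the action is $(h,g)\delta_f(x)=\delta_{h,e}\,\delta_{gf}(x)$ for $f\in G$, and $(h,g)\rho_t(l)=\delta_{h,gtg^{-1}}\,\rho_h(l)$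 for $t\in H$. It is extended to $\mathcal{F}_H$ by continuity. The observable algebra is $$\mathcal{A}_{(H,G)}=\{F\in\mathcal{F}_H\colon a(F)=\varepsilon(a)F\ \text{ for all } a\in D(H;G)\}.$$ **The elements $v_h(x)$, $w_g(l)$.** For $h\in H$, $g\in G$, $x\in\mathbb{Z}$, $l\in\mathbb{Z}+\frac12$, $$v_h(x)=\sum_{k\in G}\rho_{kh^{-1}k^{-1}}(x-\tfrac12)\,\delta_k(x)\,\rho_{khk^{-1}}(x+\tfrac12),\qquad w_g(l)=\sum_{k\in G}\delta_k(l-\tfrac12)\,\delta_{kg}(l+\tfrac12).$$ *)

theory Defs
  imports
    "HOL-Analysis.Analysis"
    "HOL-Algebra.Coset"
    "HOL-Library.Poly_Mapping"
begin

section \<open>Unital $C^*$-algebras\<close>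

class unital_cstar_algebra = real_normed_algebra_1 + banach +
  fixes scaleC :: "complex \<Rightarrow> 'a \<Rightarrow> 'a" (infixr "*\<^sub>C" 75)
    and star :: "'a \<Rightarrow> 'a"
  assumes scaleC_add_right: "a *\<^sub>C (x + y) = a *\<^sub>C x + a *\<^sub>C y"
    and scaleC_add_left: "(a + b) *\<^sub>C x = a *\<^sub>C x + b *\<^sub>C x"
    and scaleC_scaleC: "a *\<^sub>C (b *\<^sub>C x) = (a * b) *\<^sub>C x"
    and scaleR_scaleC: "r *\<^sub>R x = complex_of_real r *\<^sub>C x"
    and mult_scaleC_left: "(a *\<^sub>C x) * y = a *\<^sub>C (x * y)"
    and mult_scaleC_right: "x * (a *\<^sub>C y) = a *\<^sub>C (x * y)"
    and norm_scaleC: "norm (a *\<^sub>C x) = cmod a * norm x"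
    and star_add: "star (x + y) = star x + star y"
    and star_scaleC: "star (a *\<^sub>C x) = cnj a *\<^sub>C star x"
    and star_mult: "star (x * y) = star y * star x"
    and star_star: "star (star x) = x"
    and cstar_identity: "norm (star x * x) = (norm x)\<^sup>2"

definition cstar_subalgebra :: "'a::unital_cstar_algebra set \<Rightarrow> bool" where
  "cstar_subalgebra B \<longleftrightarrow>
     1 \<in> B \<and>
     (\<forall>x\<in>B. \<forall>y\<in>B. x + y \<in> B) \<and>
     (\<forall>c. \<forall>x\<in>B. c *\<^sub>C x \<in> B) \<and>
     (\<forall>x\<in>B. \<forall>y\<in>B. x * y \<in> B) \<and>
     (\<forall>x\<in>B. star x \<in> B) \<and>
     closed B"

definition generated_cstar_subalgebra :: "'a::unital_cstar_algebra set \<Rightarrow> 'a set" where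
  "generated_cstar_subalgebra S = cstar_subalgebra hull S"


section \<open>Free algebras\<close>

text \<open>The free monoid is wrapped in a type of its own, so that the convolution product of
  \<^theory>\<open>HOL-Library.Poly_Mapping\<close> makes \<open>'x word \<Rightarrow>\<^sub>0 complex\<close> the free unital
  \<open>\<complex>\<close>-algebra on \<open>'x\<close>.\<close>

datatype 'x word = Word (letters: "'x list")

instantiation word :: (type) monoid_add
begin
definition "0 = Word []"
definition "u + v = Word (letters u @ letters v)"
instance by standard (simp_all add: zero_word_def plus_word_def)
end

definition free_algebra :: "'x set \<Rightarrow> ('x word \<Rightarrow>\<^sub>0 complex) set" where
  "free_algebra X = {p. \<forall>w \<in> Poly_Mapping.keys p. set (letters w) \<subseteq> X}"

definition free_gen :: "'x \<Rightarrow> ('x word \<Rightarrow>\<^sub>0 complex)" where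
  "free_gen a = Poly_Mapping.single (Word [a]) 1"

definition free_eval :: "('x \<Rightarrow> 'a::unital_cstar_algebra) \<Rightarrow> ('x word \<Rightarrow>\<^sub>0 complex) \<Rightarrow> 'a" where
  "free_eval f p =
     (\<Sum>w\<in>Poly_Mapping.keys p. Poly_Mapping.lookup p w *\<^sub>C prod_list (map f (letters w)))"

definition two_sided_ideal :: "'r::ring_1 set \<Rightarrow> 'r set \<Rightarrow> bool" where
  "two_sided_ideal A I \<longleftrightarrow>
     I \<subseteq> A \<and> 0 \<in> I \<and>
     (\<forall>x\<in>I. \<forall>y\<in>I. x + y \<in> I) \<and>
     (\<forall>a\<in>A. \<forall>x\<in>I. a * x \<in> I \<and> x * a \<in> I)"

definition generated_ideal :: "'r::ring_1 set \<Rightarrow> 'r set \<Rightarrow> 'r set" where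
  "generated_ideal A R = two_sided_ideal A hull R"


section \<open>The field algebra\<close>

text \<open>Sites are rational numbers: \<open>\<delta>\<close> lives on \<open>\<int>\<close> and \<open>\<rho>\<close> on \<open>\<int> + 1/2\<close>.\<close>

definition half_ints :: "rat set" where
  "half_ints = {l. l - 1/2 \<in> \<int>}"

datatype 'g gen = Delta 'g rat | Rho 'g rat

context
  fixes G :: "('g, 'm) monoid_scheme" (structure) and H :: "'g set"
begin

definition field_gens :: "'g gen set" where
  "field_gens = {Delta g x | g x. g \<in> carrier G \<and> x \<in> \<int>} \<union>
                {Rho h l | h l. h \<in> H \<and> l \<in> half_ints}"

text \<open>A relation \<open>p = q\<close> is recorded as the element \<open>p - q\<close> of the free algebra.\<close>

definition field_relations :: "('g gen word \<Rightarrow>\<^sub>0 complex) set" where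
  "field_relations =
    (let D = (\<lambda>g x. free_gen (Delta g x)); R = (\<lambda>h l. free_gen (Rho h l)) in
     {(\<Sum>g\<in>carrier G. D g x) - 1 | x. x \<in> \<int>} \<union>
     {R \<one> l - 1 | l. l \<in> half_ints} \<union>
     {D g1 x * D g2 x - (if g1 = g2 then D g1 x else 0) | g1 g2 x.
        g1 \<in> carrier G \<and> g2 \<in> carrier G \<and> x \<in> \<int>} \<union>
     {R h1 l * R h2 l - R (h1 \<otimes> h2) l | h1 h2 l.
        h1 \<in> H \<and> h2 \<in> H \<and> l \<in> half_ints} \<union>
     {D g1 x * D g2 x' - D g2 x' * D g1 x | g1 g2 x x'.
        g1 \<in> carrier G \<and> g2 \<in> carrier G \<and> x \<in> \<int> \<and> x' \<in> \<int>} \<union>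
     {R h l * D g x - D (h \<otimes> g) x * R h l | h g l x.
        h \<in> H \<and> g \<in> carrier G \<and> l \<in> half_ints \<and> x \<in> \<int> \<and> l < x} \<union>
     {R h l * D g x - D g x * R h l | h g l x.
        h \<in> H \<and> g \<in> carrier G \<and> l \<in> half_ints \<and> x \<in> \<int> \<and> l > x} \<union>
     {R h1 l * R h2 l' - R h2 l' * R (inv h2 \<otimes> h1 \<otimes> h2) l | h1 h2 l l'.
        h1 \<in> H \<and> h2 \<in> H \<and> l \<in> half_ints \<and> l' \<in> half_ints \<and> l > l'} \<union>
     {R h1 l * R h2 l' - R (h1 \<otimes> h2 \<otimes> inv h1) l' * R h1 l | h1 h2 l l'.
        h1 \<in> H \<and> h2 \<in> H \<and> l \<in> half_ints \<and> l' \<in> half_ints \<and> l < l'})"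

text \<open>The local field algebra is \<open>free_algebra field_gens\<close> modulo the ideal generated by
  \<open>field_relations\<close>.  The predicate says that the ambient \<open>C\<^sup>*\<close>-algebra \<open>'a\<close>, with the families
  \<open>\<delta>\<close> and \<open>\<rho>\<close>, is its \<open>C\<^sup>*\<close>-completion: the kernel condition says that the local field algebra
  embeds into \<open>'a\<close>, the conditions on \<open>star\<close> that the embedding respects the involution,
  and the last condition that its image is dense.  Since the local field algebra is an
  increasing union of finite-dimensional \<open>C\<^sup>*\<close>-algebras, it has exactly one \<open>C\<^sup>*\<close>-norm, so
  this determines \<open>('a, \<delta>, \<rho>)\<close> up to isometric isomorphism.  The values of \<open>\<delta>\<close> and \<open>\<rho>\<close>
  outside \<open>field_gens\<close> play no role.\<close>

definition is_field_algebra ::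
  "('g \<Rightarrow> rat \<Rightarrow> 'a::unital_cstar_algebra) \<Rightarrow> ('g \<Rightarrow> rat \<Rightarrow> 'a) \<Rightarrow> bool" where
  "is_field_algebra \<delta> \<rho> \<longleftrightarrow>
     {p \<in> free_algebra field_gens. free_eval (case_gen \<delta> \<rho>) p = 0} =
       generated_ideal (free_algebra field_gens) field_relations \<and>
     (\<forall>g\<in>carrier G. \<forall>x\<in>\<int>. star (\<delta> g x) = \<delta> g x) \<and>
     (\<forall>h\<in>H. \<forall>l\<in>half_ints. star (\<rho> h l) = \<rho> (inv h) l) \<and>
     closure (free_eval (case_gen \<delta> \<rho>) ` free_algebra field_gens) = UNIV"


section \<open>The Hopf algebra \<open>D(H;G)\<close>\<close>

text \<open>Elements of \<open>D(H;G)\<close> are functions \<open>'g \<times> 'g \<Rightarrow> complex\<close> supported on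
  \<open>H \<times> carrier G\<close>, namely the coefficient functions with respect to the basis \<open>(h, g)\<close>;
  elements of \<open>D(H;G) \<otimes> D(H;G)\<close> are likewise functions on pairs of basis indices.\<close>

definition double_carrier :: "('g \<times> 'g \<Rightarrow> complex) set" where
  "double_carrier = {a. \<forall>p. p \<notin> H \<times> carrier G \<longrightarrow> a p = 0}"

definition double_basis :: "'g \<times> 'g \<Rightarrow> ('g \<times> 'g \<Rightarrow> complex)" where
  "double_basis p = (\<lambda>q. if q = p then 1 else 0)"

definition double_mult ::
  "('g \<times> 'g \<Rightarrow> complex) \<Rightarrow> ('g \<times> 'g \<Rightarrow> complex) \<Rightarrow> ('g \<times> 'g \<Rightarrow> complex)" where
  "double_mult a b = (\<lambda>q. \<Sum>(h1, g1)\<in>H \<times> carrier G. \<Sum>(h2, g2)\<in>H \<times> carrier G.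
     a (h1, g1) * b (h2, g2) *
       (if h1 \<otimes> g1 = g1 \<otimes> h2 then double_basis (h1, g1 \<otimes> g2) q else 0))"

definition double_one :: "'g \<times> 'g \<Rightarrow> complex" where
  "double_one = (\<lambda>q. \<Sum>h\<in>H. double_basis (h, \<one>) q)"

definition double_counit :: "('g \<times> 'g \<Rightarrow> complex) \<Rightarrow> complex" where
  "double_counit a = (\<Sum>(h, g)\<in>H \<times> carrier G. a (h, g) * (if h = \<one> then 1 else 0))"

definition double_comult ::
  "('g \<times> 'g \<Rightarrow> complex) \<Rightarrow> (('g \<times> 'g) \<times> ('g \<times> 'g) \<Rightarrow> complex)" where
  "double_comult a = (\<lambda>(q, r). \<Sum>(h, g)\<in>H \<times> carrier G.
     a (h, g) * (\<Sum>t\<in>H. double_basis (t, g) q * double_basis (inv t \<otimes> h, g) r))"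

text \<open>The fifth conjunct is \<open>a (F F') = \<Sum> a\<^sub>(\<^sub>1\<^sub>) (F) a\<^sub>(\<^sub>2\<^sub>) (F')\<close>, with the coproduct
  expanded in the basis of \<open>D(H;G) \<otimes> D(H;G)\<close>.\<close>

definition double_module_algebra ::
  "(('g \<times> 'g \<Rightarrow> complex) \<Rightarrow> 'a::unital_cstar_algebra \<Rightarrow> 'a) \<Rightarrow> bool" where
  "double_module_algebra act \<longleftrightarrow>
     (\<forall>a\<in>double_carrier. \<forall>b\<in>double_carrier. \<forall>F. act (\<lambda>q. a q + b q) F = act a F + act b F) \<and>
     (\<forall>a\<in>double_carrier. \<forall>c F. act (\<lambda>q. c * a q) F = c *\<^sub>C act a F) \<and>
     (\<forall>a\<in>double_carrier. \<forall>F F'. act a (F + F') = act a F + act a F') \<and>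
     (\<forall>a\<in>double_carrier. \<forall>c F. act a (c *\<^sub>C F) = c *\<^sub>C act a F) \<and>
     (\<forall>a\<in>double_carrier. \<forall>F F'. act a (F * F') =
        (\<Sum>q\<in>H \<times> carrier G. \<Sum>r\<in>H \<times> carrier G.
           double_comult a (q, r) *\<^sub>C (act (double_basis q) F * act (double_basis r) F'))) \<and>
     (\<forall>a\<in>double_carrier. act a 1 = double_counit a *\<^sub>C 1) \<and>
     (\<forall>a\<in>double_carrier. \<forall>b\<in>double_carrier. \<forall>F. act (double_mult a b) F = act a (act b F)) \<and>
     (\<forall>F. act double_one F = F)"


section \<open>The action on the field algebra and the observable algebra\<close>

text \<open>A module algebra structure is determined on the local field algebra by its values on
  the generators, and hence, by continuity, on the whole field algebra.\<close>

definition is_field_action ::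
  "('g \<Rightarrow> rat \<Rightarrow> 'a::unital_cstar_algebra) \<Rightarrow> ('g \<Rightarrow> rat \<Rightarrow> 'a) \<Rightarrow>
     (('g \<times> 'g \<Rightarrow> complex) \<Rightarrow> 'a \<Rightarrow> 'a) \<Rightarrow> bool" where
  "is_field_action \<delta> \<rho> act \<longleftrightarrow>
     double_module_algebra act \<and>
     (\<forall>a\<in>double_carrier. continuous_on UNIV (act a)) \<and>
     (\<forall>h\<in>H. \<forall>g\<in>carrier G. \<forall>f\<in>carrier G. \<forall>x\<in>\<int>.
        act (double_basis (h, g)) (\<delta> f x) = (if h = \<one> then \<delta> (g \<otimes> f) x else 0)) \<and>
     (\<forall>h\<in>H. \<forall>g\<in>carrier G. \<forall>t\<in>H. \<forall>l\<in>half_ints.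
        act (double_basis (h, g)) (\<rho> t l) = (if h = g \<otimes> t \<otimes> inv g then \<rho> h l else 0))"

definition observable_algebra ::
  "(('g \<times> 'g \<Rightarrow> complex) \<Rightarrow> 'a::unital_cstar_algebra \<Rightarrow> 'a) \<Rightarrow> 'a set" where
  "observable_algebra act = {F. \<forall>a\<in>double_carrier. act a F = double_counit a *\<^sub>C F}"

definition v_elem ::
  "('g \<Rightarrow> rat \<Rightarrow> 'a::unital_cstar_algebra) \<Rightarrow> ('g \<Rightarrow> rat \<Rightarrow> 'a) \<Rightarrow> 'g \<Rightarrow> rat \<Rightarrow> 'a" where
  "v_elem \<delta> \<rho> h x = (\<Sum>k\<in>carrier G.
     \<rho> (k \<otimes> inv h \<otimes> inv k) (x - 1/2) * \<delta> k x * \<rho> (k \<otimes> h \<otimes> inv k) (x + 1/2))"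

definition w_elem ::
  "('g \<Rightarrow> rat \<Rightarrow> 'a::unital_cstar_algebra) \<Rightarrow> 'g \<Rightarrow> rat \<Rightarrow> 'a" where
  "w_elem \<delta> g l = (\<Sum>k\<in>carrier G. \<delta> k (l - 1/2) * \<delta> (k \<otimes> g) (l + 1/2))"

end

end

theory Submission
  imports Defs
begin

text \<open>The algebra \<open>D(H;G)\<close> acts by an \<open>H\<close>-grading together with automorphisms \<open>\<alpha>\<^sub>g\<close>, and averaging the
  degree \<open>e\<close> parts over \<open>G\<close> is a continuous projection onto the observables; by density it suffices
  to see that it maps every monomial \<open>m\<close> of degree \<open>e\<close> into the algebra \<open>B\<close> generated by the
  \<open>v\<close> and \<open>w\<close>.  Choose a site \<open>x\<^sub>0\<close> to the left of \<open>m\<close>, so that \<open>\<delta>\<^sub>k(x\<^sub>0)\<close> commutes with everything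
  involved.  Cutting down by \<open>\<delta>\<^sub>k(x\<^sub>0)\<close> trivialises the \<open>G\<close>-action: each \<open>\<delta>\<^sub>f(x)\<close> agrees
  with an element of \<open>B\<close> after multiplication by \<open>\<delta>\<^sub>k(x\<^sub>0)\<close> (a product of \<open>w\<close>'s leads from \<open>x\<^sub>0\<close>
  to \<open>x\<close>), and so does each charge pair \<open>\<rho>\<^sub>h(l) \<rho>\<^sub>h\<^sup>-\<^sup>1(L)\<close> (a product of \<open>v\<close>'s moves \<open>h\<close> from
  \<open>l\<close> to \<open>L\<close>).  Hence \<open>m \<delta>\<^sub>k(x\<^sub>0) = A\<^sub>k \<delta>\<^sub>k(x\<^sub>0)\<close> with \<open>A\<^sub>k \<in> B\<close>, and since the \<open>A\<^sub>k\<close> are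
  invariant, \<open>\<Sum>\<^sub>g \<alpha>\<^sub>g(m) = \<Sum>\<^sub>g\<^sub>,\<^sub>k A\<^sub>k \<delta>\<^sub>g\<^sub>k(x\<^sub>0) = \<Sum>\<^sub>k A\<^sub>k\<close>.\<close>

lemma sum_eq_single:
  assumes "finite A" "a \<in> A" "\<And>x. x \<in> A \<Longrightarrow> x \<noteq> a \<Longrightarrow> f x = (0 :: 'b::comm_monoid_add)"
  shows "sum f A = f a"
  using assms sum.mono_neutral_right[of A "{a}" f] by auto

lemma mult_commutes:
  fixes a b d :: "'b::semigroup_mult"
  shows "a * d = d * a \<Longrightarrow> b * d = d * b \<Longrightarrow> (a * b) * d = d * (a * b)"
  by (metis mult.assoc)


section \<open>Unital $C^*$-algebras\<close>

lemma scaleC_zero_left [simp]: "0 *\<^sub>C (x :: 'a::unital_cstar_algebra) = 0"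
  using scaleC_add_left[of 0 0 x] by simp

lemma scaleC_zero_right [simp]: "c *\<^sub>C (0 :: 'a::unital_cstar_algebra) = 0"
  using scaleC_add_right[of c 0 0] by simp

lemma scaleC_one [simp]: "1 *\<^sub>C (x :: 'a::unital_cstar_algebra) = x"
  using scaleR_scaleC[of 1 x] by simp

lemma scaleC_minus_left: "(- c) *\<^sub>C (x :: 'a::unital_cstar_algebra) = - (c *\<^sub>C x)"
  using scaleC_add_left[of c "- c" x] by (simp add: eq_neg_iff_add_eq_0 add.commute)

lemma scaleC_sum_left:
  "(\<Sum>i\<in>A. c i) *\<^sub>C (x :: 'a::unital_cstar_algebra) = (\<Sum>i\<in>A. c i *\<^sub>C x)"
  by (induction A rule: infinite_finite_induct) (simp_all add: scaleC_add_left)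

lemma scaleC_sum_right:
  "c *\<^sub>C (\<Sum>i\<in>A. f i :: 'a::unital_cstar_algebra) = (\<Sum>i\<in>A. c *\<^sub>C f i)"
  by (induction A rule: infinite_finite_induct) (simp_all add: scaleC_add_right)

lemma bounded_linear_scaleC: "bounded_linear (\<lambda>x :: 'a::unital_cstar_algebra. c *\<^sub>C x)"
  by (rule bounded_linear_intro[where K = "cmod c"])
    (simp_all add: scaleC_add_right norm_scaleC scaleR_scaleC scaleC_scaleC mult.commute)

text \<open>The C*-identity and submultiplicativity bound the norm of \<open>y\<close> by that of
  \<open>star y\<close>; applying this to \<open>x\<close> and to \<open>star x\<close> gives
  equality. It yields the continuity of \<open>star\<close>.\<close>

lemma norm_star: "norm (star x) = norm (x :: 'a::unital_cstar_algebra)"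
proof -
  have le: "norm y \<le> norm (star y)" for y :: 'a
  proof (cases "y = 0")
    case False
    have "norm y * norm y \<le> norm (star y) * norm y"
      using norm_mult_ineq[of "star y" y] by (simp add: cstar_identity power2_eq_square)
    with False show ?thesis by simp
  qed simp
  from le[of x] le[of "star x"] show ?thesis by (simp add: star_star)
qed

lemma bounded_linear_star: "bounded_linear (star :: 'a::unital_cstar_algebra \<Rightarrow> 'a)"
  by (rule bounded_linear_intro[where K = 1])
    (simp_all add: star_add star_scaleC norm_star scaleR_scaleC)

lemma star_sum: "star (\<Sum>i\<in>A. f i :: 'a::unital_cstar_algebra) = (\<Sum>i\<in>A. star (f i))"
  using bounded_linear_star by (metis linear_simps(1) bounded_linear.linear linear_sum)

lemma star_one: "star (1 :: 'a::unital_cstar_algebra) = 1"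
  by (metis mult.left_neutral mult.right_neutral star_mult star_star)

lemma cstar_subalgebraD:
  assumes "cstar_subalgebra B"
  shows "1 \<in> B" "\<And>x y. x \<in> B \<Longrightarrow> y \<in> B \<Longrightarrow> x + y \<in> B" "\<And>c x. x \<in> B \<Longrightarrow> c *\<^sub>C x \<in> B"
    "\<And>x y. x \<in> B \<Longrightarrow> y \<in> B \<Longrightarrow> x * y \<in> B" "\<And>x. x \<in> B \<Longrightarrow> star x \<in> B" "closed B"
  using assms unfolding cstar_subalgebra_def by auto

lemma cstar_subalgebra_zero:
  assumes "cstar_subalgebra B" shows "0 \<in> B"
  using cstar_subalgebraD(3)[OF assms cstar_subalgebraD(1)[OF assms], of 0] by simp

lemma cstar_subalgebra_sum:
  assumes "cstar_subalgebra B" "\<And>i. i \<in> A \<Longrightarrow> f i \<in> B"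
  shows "(\<Sum>i\<in>A. f i) \<in> B"
  using assms(2)
  by (induction A rule: infinite_finite_induct)
    (simp_all add: cstar_subalgebra_zero cstar_subalgebraD(2) assms(1))

lemma cstar_subalgebra_generated: "cstar_subalgebra (generated_cstar_subalgebra S)"
  unfolding generated_cstar_subalgebra_def
  by (rule hull_in) (auto simp: cstar_subalgebra_def intro!: closed_Inter)

lemma generated_cstar_subalgebra_superset: "S \<subseteq> generated_cstar_subalgebra S"
  unfolding generated_cstar_subalgebra_def by (rule hull_subset)

lemma generated_cstar_subalgebra_minimal:
  "S \<subseteq> B \<Longrightarrow> cstar_subalgebra B \<Longrightarrow> generated_cstar_subalgebra S \<subseteq> B"
  unfolding generated_cstar_subalgebra_def by (rule hull_minimal)


section \<open>Evaluation of free algebra elements\<close>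

text \<open>Words outside the support have coefficient 0, so two elements with different supports
  can be evaluated over one common finite index set.\<close>

lemma free_eval_superset:
  assumes "finite A" "Poly_Mapping.keys p \<subseteq> A"
  shows "free_eval f p = (\<Sum>w\<in>A. Poly_Mapping.lookup p w *\<^sub>C prod_list (map f (letters w)))"
  unfolding free_eval_def using assms
  by (intro sum.mono_neutral_left) (auto simp: in_keys_iff)

lemma free_eval_add: "free_eval f (p + q) = free_eval f p + free_eval f q"
proof -
  let ?A = "Poly_Mapping.keys p \<union> Poly_Mapping.keys q"
  have "finite ?A" by simp
  moreover have "Poly_Mapping.keys (p + q) \<subseteq> ?A" by (rule Poly_Mapping.keys_add)
  ultimately show ?thesis
    by (simp add: free_eval_superset[of ?A] lookup_add scaleC_add_left sum.distrib)
qed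

lemma free_eval_uminus: "free_eval f (- p) = - free_eval f p"
  by (simp add: free_eval_def keys_minus scaleC_minus_left sum_negf)

lemma free_eval_diff: "free_eval f (p - q) = free_eval f p - free_eval f q"
  using free_eval_add[of f p "- q"] by (simp add: free_eval_uminus)

lemma free_eval_zero: "free_eval f 0 = 0"
  by (simp add: free_eval_def)

lemma free_eval_sum: "free_eval f (\<Sum>i\<in>A. p i) = (\<Sum>i\<in>A. free_eval f (p i))"
  by (induction A rule: infinite_finite_induct) (simp_all add: free_eval_zero free_eval_add)

lemma free_eval_gen: "free_eval f (free_gen a) = f a"
  by (simp add: free_eval_def free_gen_def)

lemma free_eval_one: "free_eval f 1 = 1"
proof -
  have "free_eval f (Poly_Mapping.single 0 1) = 1"
    by (simp add: free_eval_def zero_word_def)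
  then show ?thesis by simp
qed

text \<open>Every product occurring in a defining relation has exactly two generators as factors, so
  this case of multiplicativity is enough to evaluate the relations.\<close>

lemma free_eval_gen_mult: "free_eval f (free_gen a * free_gen b) = f a * f b"
  by (simp add: free_eval_def free_gen_def mult_single plus_word_def)

lemmas free_eval_simps =
  free_eval_diff free_eval_zero free_eval_sum free_eval_gen free_eval_one free_eval_gen_mult

lemma generated_ideal_superset: "R \<subseteq> generated_ideal A R"
  unfolding generated_ideal_def by (rule hull_subset)


section \<open>Sites\<close>

lemma half_ints_shift:
  "x \<in> \<int> \<Longrightarrow> x - 1/2 \<in> half_ints" "x \<in> \<int> \<Longrightarrow> x + 1/2 \<in> half_ints"
  "l \<in> half_ints \<Longrightarrow> l - 1/2 \<in> \<int>" "l \<in> half_ints \<Longrightarrow> l + 1/2 \<in> \<int>"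
  "l \<in> half_ints \<Longrightarrow> l + of_nat n \<in> half_ints"
proof -
  show "x \<in> \<int> \<Longrightarrow> x - 1/2 \<in> half_ints"
    using Ints_diff[of x 1] by (simp add: half_ints_def)
  show "x \<in> \<int> \<Longrightarrow> x + 1/2 \<in> half_ints" by (simp add: half_ints_def)
  show "l \<in> half_ints \<Longrightarrow> l - 1/2 \<in> \<int>" by (simp add: half_ints_def)
  show "l \<in> half_ints \<Longrightarrow> l + 1/2 \<in> \<int>"
    using Ints_add[of "l - 1/2" 1] by (simp add: half_ints_def add.commute)
  show "l \<in> half_ints \<Longrightarrow> l + of_nat n \<in> half_ints"
    using Ints_add[of "l - 1/2" "of_nat n"] by (simp add: half_ints_def algebra_simps)
qed

text \<open>Converts the order of two sites into a natural number distance, over which the transport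
  arguments run by induction.\<close>

lemma Ints_diff_of_nat:
  fixes x y :: rat
  assumes "y - x \<in> \<int>" "x \<le> y"
  obtains n where "y = x + of_nat n"
proof -
  from assms(1) obtain k where k: "y - x = of_int k" by (auto elim: Ints_cases)
  with assms(2) have "k \<ge> 0" by (metis diff_ge_0_iff_ge of_int_0_le_iff)
  then have "y = x + of_nat (nat k)" using k by simp
  then show ?thesis by (rule that)
qed

lemma half_ints_diff: "l \<in> half_ints \<Longrightarrow> l' \<in> half_ints \<Longrightarrow> l' - l \<in> \<int>"
  using Ints_diff[of "l' - 1/2" "l - 1/2"] by (simp add: half_ints_def)

fun gen_site :: "'g gen \<Rightarrow> rat" where
  "gen_site (Delta g x) = x"
| "gen_site (Rho h l) = l"

text \<open>The sum of the absolute values dominates each of them. The bound leaves room for one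
  site to the left and one to the right of a given monomial.\<close>

lemma word_sites_bounded:
  obtains n :: nat where "\<And>y. y \<in> set ys \<Longrightarrow> \<bar>gen_site y\<bar> < of_nat n"
proof -
  obtain n :: nat where n: "(\<Sum>y\<in>set ys. \<bar>gen_site y\<bar>) < of_nat n"
    using reals_Archimedean2 by blast
  have "\<bar>gen_site y\<bar> < of_nat n" if "y \<in> set ys" for y
    using n member_le_sum[OF that, of "\<lambda>y. \<bar>gen_site y\<bar>"] by simp
  then show ?thesis by (rule that)
qed


section \<open>The field algebra and its module structure\<close>

locale field_system = normal H G
  for H :: "'g set" and G :: "('g, 'm) monoid_scheme" (structure) +
  fixes \<delta> \<rho> :: "'g \<Rightarrow> rat \<Rightarrow> 'a::unital_cstar_algebra"
    and act :: "('g \<times> 'g \<Rightarrow> complex) \<Rightarrow> 'a \<Rightarrow> 'a"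
  assumes finite_carrier [simp]: "finite (carrier G)"
    and field_algebra: "is_field_algebra G H \<delta> \<rho>"
    and field_action: "is_field_action G H \<delta> \<rho> act"
begin

section \<open>Group preliminaries and the defining relations as identities\<close>

lemma finite_H [simp]: "finite H"
  using finite_carrier subset by (rule finite_subset[rotated])

lemma conj_closed: "g \<in> carrier G \<Longrightarrow> h \<in> H \<Longrightarrow> g \<otimes> h \<otimes> inv g \<in> H"
  by (rule inv_op_closed2)

lemma conj_inv_closed: "g \<in> carrier G \<Longrightarrow> h \<in> H \<Longrightarrow> inv g \<otimes> h \<otimes> g \<in> H"
  by (rule inv_op_closed1)

lemma cancel:
  "x \<in> carrier G \<Longrightarrow> y \<in> carrier G \<Longrightarrow> inv x \<otimes> (x \<otimes> y) = y"
  "x \<in> carrier G \<Longrightarrow> y \<in> carrier G \<Longrightarrow> x \<otimes> (inv x \<otimes> y) = y"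
  by (simp_all add: m_assoc[symmetric])

text \<open>The kernel of evaluation is the ideal generated by the relations, hence contains each of
  them.\<close>

lemma relation_eval:
  assumes "p \<in> field_relations G H"
  shows "free_eval (case_gen \<delta> \<rho>) p = 0"
  using assms generated_ideal_superset[of "field_relations G H"] field_algebra
  unfolding is_field_algebra_def by blast

lemma sum_delta:
  assumes "x \<in> \<int>"
  shows "(\<Sum>g\<in>carrier G. \<delta> g x) = 1"
proof -
  have "(\<Sum>g\<in>carrier G. free_gen (Delta g x)) - 1 \<in> field_relations G H"
    unfolding field_relations_def Let_def
    \<comment> \<open>The union of the nine families of relations nests to the left; the chain of
      \<open>UnI1\<close> and \<open>UnI2\<close> selects the family, here the first one.\<close>
    by (rule UnI1, rule UnI1, rule UnI1, rule UnI1, rule UnI1, rule UnI1, rule UnI1, rule UnI1,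
        intro CollectI exI conjI, rule refl)
      (use assms in simp_all)
  from relation_eval[OF this] show ?thesis by (simp add: free_eval_simps)
qed

lemma rho_one:
  assumes "l \<in> half_ints"
  shows "\<rho> \<one> l = 1"
proof -
  have "free_gen (Rho \<one> l) - 1 \<in> field_relations G H"
    unfolding field_relations_def Let_def
    by (rule UnI1, rule UnI1, rule UnI1, rule UnI1, rule UnI1, rule UnI1, rule UnI1, rule UnI2,
        intro CollectI exI conjI, rule refl)
      (use assms in simp_all)
  from relation_eval[OF this] show ?thesis by (simp add: free_eval_simps)
qed

lemma delta_mult:
  assumes "g1 \<in> carrier G" "g2 \<in> carrier G" "x \<in> \<int>"
  shows "\<delta> g1 x * \<delta> g2 x = (if g1 = g2 then \<delta> g1 x else 0)"
proof -
  have "free_gen (Delta g1 x) * free_gen (Delta g2 x) -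
      (if g1 = g2 then free_gen (Delta g1 x) else 0) \<in> field_relations G H"
    unfolding field_relations_def Let_def
    by (rule UnI1, rule UnI1, rule UnI1, rule UnI1, rule UnI1, rule UnI1, rule UnI2,
        intro CollectI exI conjI, rule refl)
      (use assms in simp_all)
  from relation_eval[OF this] show ?thesis by (simp add: free_eval_simps split: if_splits)
qed

lemma rho_mult:
  assumes "h1 \<in> H" "h2 \<in> H" "l \<in> half_ints"
  shows "\<rho> h1 l * \<rho> h2 l = \<rho> (h1 \<otimes> h2) l"
proof -
  have "free_gen (Rho h1 l) * free_gen (Rho h2 l)
      - free_gen (Rho (h1 \<otimes> h2) l) \<in> field_relations G H"
    unfolding field_relations_def Let_def
    by (rule UnI1, rule UnI1, rule UnI1, rule UnI1, rule UnI1, rule UnI2,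
        intro CollectI exI conjI, rule refl)
      (use assms in simp_all)
  from relation_eval[OF this] show ?thesis by (simp add: free_eval_simps)
qed

lemma delta_commute:
  assumes "g1 \<in> carrier G" "g2 \<in> carrier G" "x \<in> \<int>" "x' \<in> \<int>"
  shows "\<delta> g1 x * \<delta> g2 x' = \<delta> g2 x' * \<delta> g1 x"
proof -
  have "free_gen (Delta g1 x) * free_gen (Delta g2 x')
      - free_gen (Delta g2 x') * free_gen (Delta g1 x) \<in> field_relations G H"
    unfolding field_relations_def Let_def
    by (rule UnI1, rule UnI1, rule UnI1, rule UnI1, rule UnI2,
        intro CollectI exI conjI, rule refl)
      (use assms in simp_all)
  from relation_eval[OF this] show ?thesis by (simp add: free_eval_simps)
qed

lemma rho_delta_left:
  assumes "h \<in> H" "g \<in> carrier G" "l \<in> half_ints" "x \<in> \<int>" "l < x"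
  shows "\<rho> h l * \<delta> g x = \<delta> (h \<otimes> g) x * \<rho> h l"
proof -
  have "free_gen (Rho h l) * free_gen (Delta g x)
      - free_gen (Delta (h \<otimes> g) x) * free_gen (Rho h l) \<in> field_relations G H"
    unfolding field_relations_def Let_def
    by (rule UnI1, rule UnI1, rule UnI1, rule UnI2, intro CollectI exI conjI, rule refl)
      (use assms in simp_all)
  from relation_eval[OF this] show ?thesis by (simp add: free_eval_simps)
qed

lemma rho_delta_right:
  assumes "h \<in> H" "g \<in> carrier G" "l \<in> half_ints" "x \<in> \<int>" "x < l"
  shows "\<rho> h l * \<delta> g x = \<delta> g x * \<rho> h l"
proof -
  have "free_gen (Rho h l) * free_gen (Delta g x)
      - free_gen (Delta g x) * free_gen (Rho h l) \<in> field_relations G H"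
    unfolding field_relations_def Let_def
    by (rule UnI1, rule UnI1, rule UnI2, intro CollectI exI conjI, rule refl)
      (use assms in simp_all)
  from relation_eval[OF this] show ?thesis by (simp add: free_eval_simps)
qed

text \<open>At distinct sites this is the exchange relation; at a common site both sides multiply to
  the charge \<open>h1 \<otimes> h2\<close>.\<close>

lemma rho_rho:
  assumes "h1 \<in> H" "h2 \<in> H" "l \<in> half_ints" "l' \<in> half_ints" "l' \<le> l"
  shows "\<rho> h1 l * \<rho> h2 l' = \<rho> h2 l' * \<rho> (inv h2 \<otimes> h1 \<otimes> h2) l"
proof (cases "l' = l")
  case True
  then show ?thesis using assms by (simp add: rho_mult conj_inv_closed m_assoc cancel)
next
  case False
  then have "l > l'" using assms by simp
  have "free_gen (Rho h1 l) * free_gen (Rho h2 l')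
      - free_gen (Rho h2 l') * free_gen (Rho (inv h2 \<otimes> h1 \<otimes> h2) l) \<in> field_relations G H"
    unfolding field_relations_def Let_def
    by (rule UnI1, rule UnI2, intro CollectI exI conjI, rule refl)
      (use assms \<open>l > l'\<close> in simp_all)
  from relation_eval[OF this] show ?thesis by (simp add: free_eval_simps)
qed

lemma star_delta: "g \<in> carrier G \<Longrightarrow> x \<in> \<int> \<Longrightarrow> star (\<delta> g x) = \<delta> g x"
  using field_algebra by (simp add: is_field_algebra_def)

lemma star_rho: "h \<in> H \<Longrightarrow> l \<in> half_ints \<Longrightarrow> star (\<rho> h l) = \<rho> (inv h) l"
  using field_algebra by (simp add: is_field_algebra_def)

section \<open>The action in terms of the basis of D(H;G)\<close>

abbreviation act_basis :: "'g \<Rightarrow> 'g \<Rightarrow> 'a \<Rightarrow> 'a" where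
  "act_basis h g \<equiv> act (double_basis (h, g))"

lemma double_basis_carrier:
  "p \<in> H \<times> carrier G \<Longrightarrow> double_basis p \<in> double_carrier G H"
  by (auto simp: double_carrier_def double_basis_def)

lemma act_add: "a \<in> double_carrier G H \<Longrightarrow> act a (F + F') = act a F + act a F'"
  and act_scaleC: "a \<in> double_carrier G H \<Longrightarrow> act a (c *\<^sub>C F) = c *\<^sub>C act a F"
  and act_one: "a \<in> double_carrier G H \<Longrightarrow> act a 1 = double_counit G H a *\<^sub>C 1"
  and act_mult: "a \<in> double_carrier G H \<Longrightarrow> act a (F * F') =
        (\<Sum>q\<in>H \<times> carrier G. \<Sum>r\<in>H \<times> carrier G.
           double_comult G H a (q, r) *\<^sub>C (act (double_basis q) F * act (double_basis r) F'))"
  using field_action by (simp_all add: is_field_action_def double_module_algebra_def)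

lemma act_add_left: "a \<in> double_carrier G H \<Longrightarrow> b \<in> double_carrier G H \<Longrightarrow>
    act (\<lambda>q. a q + b q) F = act a F + act b F"
  and act_scale_left: "a \<in> double_carrier G H \<Longrightarrow> act (\<lambda>q. c * a q) F = c *\<^sub>C act a F"
  and continuous_act: "a \<in> double_carrier G H \<Longrightarrow> continuous_on UNIV (act a)"
  using field_action by (simp_all add: is_field_action_def double_module_algebra_def)

lemma act_zero: "a \<in> double_carrier G H \<Longrightarrow> act a 0 = 0"
  using act_scaleC[of a 0 0] by simp

lemma act_sum: "a \<in> double_carrier G H \<Longrightarrow> act a (\<Sum>i\<in>A. F i) = (\<Sum>i\<in>A. act a (F i))"
  by (induction A rule: infinite_finite_induct) (simp_all add: act_add act_zero)

lemma act_sum_left: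
  assumes "finite A" "A \<subseteq> H \<times> carrier G"
  shows "act (\<lambda>q. \<Sum>p\<in>A. c p * double_basis p q) F = (\<Sum>p\<in>A. c p *\<^sub>C act (double_basis p) F)"
  using assms
proof (induction A rule: finite_induct)
  case empty
  \<comment> \<open>The empty combination is the zero function; it is written as 0 times a basis
    element so that linearity in the first argument applies.\<close>
  have "double_basis (\<one>, \<one>) \<in> double_carrier G H" by (rule double_basis_carrier) simp
  from act_scale_left[OF this, of 0 F] show ?case by simp
next
  case (insert p A)
  have "(\<lambda>q. c p * double_basis p q) \<in> double_carrier G H"
    using double_basis_carrier[of p] insert.prems by (simp add: double_carrier_def)
  moreover have "(\<lambda>q. \<Sum>p\<in>A. c p * double_basis p q) \<in> double_carrier G H"
    using insert.prems by (auto simp: double_carrier_def double_basis_def intro!: sum.neutral)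
  ultimately show ?case
    using insert act_scale_left[OF double_basis_carrier[of p], of "c p" F]
    by (simp add: act_add_left)
qed

lemma counit_basis:
  assumes "h \<in> H" "g \<in> carrier G"
  shows "double_counit G H (double_basis (h, g)) = (if h = \<one> then 1 else 0)"
  unfolding double_counit_def
  by (subst sum_eq_single[where a = "(h, g)"]) (use assms in \<open>auto simp: double_basis_def split: if_splits\<close>)

lemma comult_basis:
  assumes "h \<in> H" "g \<in> carrier G"
  shows "double_comult G H (double_basis (h, g)) (q, r) =
    (\<Sum>t\<in>H. if q = (t, g) \<and> r = (inv t \<otimes> h, g) then 1 else 0)"
  unfolding double_comult_def prod.case
  by (subst sum_eq_single[where a = "(h, g)"])
    (use assms in \<open>auto simp: double_basis_def split: if_splits intro!: sum.cong\<close>)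

text \<open>The coproduct of \<open>(h, g)\<close> has one term for each \<open>t\<close>, so once
  the sum over \<open>t\<close> is moved outside, the double sum over basis pairs collapses to one
  pair.\<close>

lemma act_basis_mult:
  assumes "h \<in> H" "g \<in> carrier G"
  shows "act_basis h g (F * F') = (\<Sum>t\<in>H. act_basis t g F * act_basis (inv t \<otimes> h) g F')"
proof -
  let ?I = "H \<times> carrier G" and ?X = "\<lambda>q r. act (double_basis q) F * act (double_basis r) F'"
  have "act_basis h g (F * F') = (\<Sum>q\<in>?I. \<Sum>r\<in>?I. \<Sum>t\<in>H.
      (if q = (t, g) \<and> r = (inv t \<otimes> h, g) then 1 else 0) *\<^sub>C ?X q r)"
    using assms by (simp add: act_mult double_basis_carrier comult_basis scaleC_sum_left)
  also have "\<dots> = (\<Sum>t\<in>H. \<Sum>q\<in>?I. \<Sum>r\<in>?I.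
      (if q = (t, g) \<and> r = (inv t \<otimes> h, g) then 1 else 0) *\<^sub>C ?X q r)"
    by (subst sum.swap[of _ ?I H], subst sum.swap[of _ ?I H]) (rule refl)
  also have "\<dots> = (\<Sum>t\<in>H. ?X (t, g) (inv t \<otimes> h, g))"
  proof (rule sum.cong)
    fix t assume t: "t \<in> H"
    have mem: "(t, g) \<in> ?I" "(inv t \<otimes> h, g) \<in> ?I" using t assms by auto
    have fin: "finite ?I" by simp
    show "(\<Sum>q\<in>?I. \<Sum>r\<in>?I. (if q = (t, g) \<and> r = (inv t \<otimes> h, g) then 1 else 0) *\<^sub>C ?X q r)
        = ?X (t, g) (inv t \<otimes> h, g)"
      by (subst sum_eq_single[OF fin mem(1)], simp, subst sum_eq_single[OF fin mem(2)]) auto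
  qed simp
  finally show ?thesis .
qed

lemma act_delta: "h \<in> H \<Longrightarrow> g \<in> carrier G \<Longrightarrow> f \<in> carrier G \<Longrightarrow> x \<in> \<int> \<Longrightarrow>
    act_basis h g (\<delta> f x) = (if h = \<one> then \<delta> (g \<otimes> f) x else 0)"
  and act_rho: "h \<in> H \<Longrightarrow> g \<in> carrier G \<Longrightarrow> t \<in> H \<Longrightarrow> l \<in> half_ints \<Longrightarrow>
    act_basis h g (\<rho> t l) = (if h = g \<otimes> t \<otimes> inv g then \<rho> h l else 0)"
  using field_action by (simp_all add: is_field_action_def)

text \<open>\<open>D(H;G)\<close> acts by an \<open>H\<close>-grading (the part \<open>C(H)\<close>) together with an action of \<open>G\<close>:
  \<open>homogeneous d F \<Phi>\<close> says that \<open>F\<close> has degree \<open>d\<close> and that \<open>g\<close> moves it to \<open>\<Phi> g\<close>.\<close>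

definition homogeneous :: "'g \<Rightarrow> 'a \<Rightarrow> ('g \<Rightarrow> 'a) \<Rightarrow> bool" where
  "homogeneous d F \<Phi> \<longleftrightarrow> (\<forall>h\<in>H. \<forall>g\<in>carrier G.
     act_basis h g F = (if h = g \<otimes> d \<otimes> inv g then \<Phi> g else 0))"

lemma homogeneous_delta:
  "f \<in> carrier G \<Longrightarrow> x \<in> \<int> \<Longrightarrow> homogeneous \<one> (\<delta> f x) (\<lambda>g. \<delta> (g \<otimes> f) x)"
  by (auto simp: homogeneous_def act_delta)

lemma homogeneous_rho:
  "t \<in> H \<Longrightarrow> l \<in> half_ints \<Longrightarrow> homogeneous t (\<rho> t l) (\<lambda>g. \<rho> (g \<otimes> t \<otimes> inv g) l)"
  by (auto simp: homogeneous_def act_rho)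

lemma homogeneous_one: "homogeneous \<one> 1 (\<lambda>g. 1)"
  by (auto simp: homogeneous_def act_one double_basis_carrier counit_basis)

text \<open>In the coproduct formula only \<open>t = g \<otimes> d \<otimes> inv g\<close> survives
  on the first factor. The second factor then forces \<open>h\<close> to be the product of the two
  conjugates, which is the conjugate of \<open>d \<otimes> d'\<close>.\<close>

lemma homogeneous_mult:
  assumes "homogeneous d F \<Phi>" "homogeneous d' F' \<Phi>'" "d \<in> H" "d' \<in> H"
  shows "homogeneous (d \<otimes> d') (F * F') (\<lambda>g. \<Phi> g * \<Phi>' g)"
  unfolding homogeneous_def
proof (intro ballI)
  fix h g assume h: "h \<in> H" and g: "g \<in> carrier G"
  note [simp] = mem_carrier conj_closed
  let ?t = "g \<otimes> d \<otimes> inv g"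
  have conj: "g \<otimes> (d \<otimes> d') \<otimes> inv g = ?t \<otimes> (g \<otimes> d' \<otimes> inv g)"
    using g assms by (simp add: m_assoc inv_mult_group cancel)
  have iff: "inv ?t \<otimes> h = g \<otimes> d' \<otimes> inv g \<longleftrightarrow> h = g \<otimes> (d \<otimes> d') \<otimes> inv g"
    unfolding conj using g h assms by (intro inv_solve_left') auto
  have "act_basis h g (F * F') = (\<Sum>t\<in>H. if t = ?t
      then (if inv ?t \<otimes> h = g \<otimes> d' \<otimes> inv g then \<Phi> g * \<Phi>' g else 0) else 0)"
    unfolding act_basis_mult[OF h g] using assms h g
    by (intro sum.cong) (auto simp: homogeneous_def)
  also have "\<dots> = (if h = g \<otimes> (d \<otimes> d') \<otimes> inv g then \<Phi> g * \<Phi>' g else 0)"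
    using g assms unfolding iff by (subst sum.delta) auto
  finally show "act_basis h g (F * F') = \<dots>" .
qed

lemma homogeneous_sum:
  "(\<And>i. i \<in> A \<Longrightarrow> homogeneous d (F i) (\<Phi> i)) \<Longrightarrow>
    homogeneous d (\<Sum>i\<in>A. F i) (\<lambda>g. \<Sum>i\<in>A. \<Phi> i g)"
  by (auto simp: homogeneous_def act_sum double_basis_carrier)


section \<open>The observable algebra\<close>

abbreviation \<O> where "\<O> \<equiv> observable_algebra G H act"

text \<open>Invariance is linear in the acting element, so it can be tested on the basis, where the
  counit is the indicator of \<open>h = \<one>\<close>.\<close>

lemma observable_iff_homogeneous: "F \<in> \<O> \<longleftrightarrow> homogeneous \<one> F (\<lambda>g. F)"
proof
  assume "F \<in> \<O>"
  then show "homogeneous \<one> F (\<lambda>g. F)"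
    by (auto simp: homogeneous_def observable_algebra_def double_basis_carrier counit_basis)
next
  assume F: "homogeneous \<one> F (\<lambda>g. F)"
  have "act a F = double_counit G H a *\<^sub>C F" if "a \<in> double_carrier G H" for a
  proof -
    have fin: "finite (H \<times> carrier G)" by simp
    have "a q = (\<Sum>p\<in>H \<times> carrier G. a p * double_basis p q)" for q
    proof -
      have "a q = 0" if "q \<notin> H \<times> carrier G"
        using that \<open>a \<in> double_carrier G H\<close> unfolding double_carrier_def by blast
      then show ?thesis
      proof (cases "q \<in> H \<times> carrier G")
        case True
        then show ?thesis
          by (subst sum_eq_single[OF fin, of q]) (auto simp: double_basis_def)
      next
        case False
        then have "(\<Sum>p\<in>H \<times> carrier G. a p * double_basis p q) = 0"
          by (intro sum.neutral) (auto simp: double_basis_def)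
        with \<open>q \<notin> H \<times> carrier G \<Longrightarrow> a q = 0\<close> False show ?thesis by simp
      qed
    qed
    then have "a = (\<lambda>q. \<Sum>p\<in>H \<times> carrier G. a p * double_basis p q)" by blast
    then have "act a F = act (\<lambda>q. \<Sum>p\<in>H \<times> carrier G. a p * double_basis p q) F" by metis
    also have "\<dots> = (\<Sum>p\<in>H \<times> carrier G. a p *\<^sub>C act (double_basis p) F)"
      using fin by (simp add: act_sum_left)
    also have "\<dots> = double_counit G H a *\<^sub>C F"
      unfolding double_counit_def scaleC_sum_left using F
      by (intro sum.cong) (auto simp: homogeneous_def)
    finally show ?thesis .
  qed
  then show "F \<in> \<O>" by (simp add: observable_algebra_def)
qed

lemma observable_mult: "F \<in> \<O> \<Longrightarrow> F' \<in> \<O> \<Longrightarrow> F * F' \<in> \<O>"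
  unfolding observable_iff_homogeneous using homogeneous_mult[of \<one> F _ \<one> F'] by simp

lemma closed_observable: "closed \<O>"
proof -
  have "closed {F. act a F = double_counit G H a *\<^sub>C F}" if "a \<in> double_carrier G H" for a
    using continuous_act[OF that] linear_continuous_on[OF bounded_linear_scaleC]
    by (rule closed_Collect_eq)
  moreover have "\<O> = (\<Inter>a\<in>double_carrier G H. {F. act a F = double_counit G H a *\<^sub>C F})"
    by (auto simp: observable_algebra_def)
  ultimately show ?thesis by (auto intro!: closed_Inter)
qed

text \<open>The axioms for \<open>act\<close> do not mention \<open>star\<close>, so adjoints of
  observables are not at once observable. Requiring this of both \<open>F\<close> and
  \<open>star F\<close> makes the set closed under adjoints by construction, and the set still
  contains the generators.\<close>

lemma cstar_subalgebra_observable_star: "cstar_subalgebra {F \<in> \<O>. star F \<in> \<O>}"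
proof -
  have "closed {F. star F \<in> \<O>}"
    using closed_vimage[OF closed_observable linear_continuous_on[OF bounded_linear_star]]
    by (simp add: vimage_def)
  then have "closed {F \<in> \<O>. star F \<in> \<O>}"
    using closed_observable by (simp add: closed_Collect_conj)
  moreover have "1 \<in> \<O>" using homogeneous_one by (simp add: observable_iff_homogeneous)
  moreover have "x + y \<in> \<O>" if "x \<in> \<O>" "y \<in> \<O>" for x y
    using that by (simp add: observable_algebra_def act_add scaleC_add_right)
  moreover have "c *\<^sub>C x \<in> \<O>" if "x \<in> \<O>" for c x
    using that
    by (simp add: observable_algebra_def act_scaleC scaleC_scaleC mult.commute)
  ultimately show ?thesis
    unfolding cstar_subalgebra_def
    by (auto simp: star_one star_add star_scaleC star_mult star_star observable_mult)
qed

section \<open>Invariance and adjoints of the generators\<close>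

lemma sum_carrier_left_mult:
  assumes "g \<in> carrier G"
  shows "(\<Sum>k\<in>carrier G. F (g \<otimes> k)) = (\<Sum>k\<in>carrier G. F k)"
  by (rule sum.reindex_bij_witness[where i = "\<lambda>k. inv g \<otimes> k" and j = "\<lambda>k. g \<otimes> k"])
    (use assms in \<open>simp_all add: m_assoc[symmetric]\<close>)

lemma sum_carrier_right_mult:
  assumes "g \<in> carrier G"
  shows "(\<Sum>k\<in>carrier G. F (k \<otimes> g)) = (\<Sum>k\<in>carrier G. F k)"
  by (rule sum.reindex_bij_witness[where i = "\<lambda>k. k \<otimes> inv g" and j = "\<lambda>k. k \<otimes> g"])
    (use assms in \<open>simp_all add: m_assoc\<close>)

text \<open>The action of \<open>g\<close> permutes the summands by left translation. Both
  \<open>v\<close> and \<open>w\<close> are sums of this kind.\<close>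

lemma observable_orbit_sum:
  assumes "\<And>k. k \<in> carrier G \<Longrightarrow> homogeneous \<one> (F k) (\<lambda>g. F (g \<otimes> k))"
  shows "(\<Sum>k\<in>carrier G. F k) \<in> \<O>"
  using homogeneous_sum[OF assms, of "carrier G"]
  by (auto simp: observable_iff_homogeneous homogeneous_def sum_carrier_left_mult)

lemma conj_mult: "a \<in> carrier G \<Longrightarrow> b \<in> carrier G \<Longrightarrow> h \<in> carrier G \<Longrightarrow>
    a \<otimes> (b \<otimes> h \<otimes> inv b) \<otimes> inv a = a \<otimes> b \<otimes> h \<otimes> inv (a \<otimes> b)"
  by (simp add: m_assoc inv_mult_group)

lemma conj_inv_mult_conj: "k \<in> carrier G \<Longrightarrow> h \<in> carrier G \<Longrightarrow>
    (k \<otimes> inv h \<otimes> inv k) \<otimes> (k \<otimes> h \<otimes> inv k) = \<one>"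
  by (simp add: m_assoc cancel)

lemma inv_conj: "k \<in> carrier G \<Longrightarrow> h \<in> carrier G \<Longrightarrow> inv (k \<otimes> h \<otimes> inv k) = k \<otimes> inv h \<otimes> inv k"
  by (simp add: m_assoc inv_mult_group)

abbreviation "v \<equiv> v_elem G \<delta> \<rho>"
abbreviation "w \<equiv> w_elem G \<delta>"

text \<open>The two charges in a summand are inverse to each other, so its total degree is
  \<open>\<one>\<close>; \<open>g\<close> sends the summand at \<open>k\<close> to the one at
  \<open>g \<otimes> k\<close>.\<close>

lemma v_observable:
  assumes "h \<in> H" "x \<in> \<int>"
  shows "v h x \<in> \<O>"
  unfolding v_elem_def
proof (rule observable_orbit_sum)
  fix k assume k: "k \<in> carrier G"
  have mem: "k \<otimes> inv h \<otimes> inv k \<in> H" "k \<otimes> h \<otimes> inv k \<in> H"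
    using k assms by (simp_all add: conj_closed)
  let ?\<Phi> = "\<lambda>g. \<rho> (g \<otimes> (k \<otimes> inv h \<otimes> inv k) \<otimes> inv g) (x - 1/2) * \<delta> (g \<otimes> k) x
    * \<rho> (g \<otimes> (k \<otimes> h \<otimes> inv k) \<otimes> inv g) (x + 1/2)"
  have "homogeneous ((k \<otimes> inv h \<otimes> inv k) \<otimes> \<one> \<otimes> (k \<otimes> h \<otimes> inv k))
     (\<rho> (k \<otimes> inv h \<otimes> inv k) (x - 1/2) * \<delta> k x * \<rho> (k \<otimes> h \<otimes> inv k) (x + 1/2)) ?\<Phi>"
    using k assms mem by (intro homogeneous_mult homogeneous_delta homogeneous_rho)
      (auto simp: half_ints_shift)
  then show "homogeneous \<one>
      (\<rho> (k \<otimes> inv h \<otimes> inv k) (x - 1/2) * \<delta> k x * \<rho> (k \<otimes> h \<otimes> inv k) (x + 1/2))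
      (\<lambda>g. \<rho> (g \<otimes> k \<otimes> inv h \<otimes> inv (g \<otimes> k)) (x - 1/2) * \<delta> (g \<otimes> k) x
        * \<rho> (g \<otimes> k \<otimes> h \<otimes> inv (g \<otimes> k)) (x + 1/2))"
    using k assms mem
    by (simp add: homogeneous_def conj_mult conj_inv_mult_conj mem_carrier)
qed

lemma w_observable:
  assumes "g \<in> carrier G" "l \<in> half_ints"
  shows "w g l \<in> \<O>"
  unfolding w_elem_def
proof (rule observable_orbit_sum)
  fix k assume k: "k \<in> carrier G"
  have "homogeneous (\<one> \<otimes> \<one>) (\<delta> k (l - 1/2) * \<delta> (k \<otimes> g) (l + 1/2))
     (\<lambda>a. \<delta> (a \<otimes> k) (l - 1/2) * \<delta> (a \<otimes> (k \<otimes> g)) (l + 1/2))"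
    using k assms by (intro homogeneous_mult homogeneous_delta) (auto simp: half_ints_shift)
  then show "homogeneous \<one> (\<delta> k (l - 1/2) * \<delta> (k \<otimes> g) (l + 1/2))
     (\<lambda>a. \<delta> (a \<otimes> k) (l - 1/2) * \<delta> (a \<otimes> k \<otimes> g) (l + 1/2))"
    using k assms by (simp add: homogeneous_def m_assoc)
qed

lemma star_w:
  assumes "g \<in> carrier G" "l \<in> half_ints"
  shows "star (w g l) = w g l"
  unfolding w_elem_def star_sum star_mult using assms
  by (intro sum.cong) (simp_all add: star_delta half_ints_shift delta_commute)

text \<open>The adjoint reverses the three factors. Moving the left charge back across
  \<open>\<delta> k x\<close> shifts \<open>k\<close> to \<open>k \<otimes> inv h\<close>, the
  mutually inverse charges pass each other unchanged, and a right translation of the summation index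
  absorbs the shift.\<close>

lemma star_v:
  assumes h: "h \<in> H" and x: "x \<in> \<int>"
  shows "star (v h x) = v (inv h) x"
proof -
  let ?l = "x - 1/2" and ?r = "x + 1/2"
  define F where "F k = \<rho> (k \<otimes> h \<otimes> inv k) ?l * \<delta> k x * \<rho> (k \<otimes> inv h \<otimes> inv k) ?r" for k
  have hc: "h \<in> carrier G" using h by (rule mem_carrier)
  have "star (v h x) = (\<Sum>k\<in>carrier G. \<rho> (k \<otimes> inv h \<otimes> inv k) ?r *
      (\<delta> k x * \<rho> (k \<otimes> h \<otimes> inv k) ?l))"
    unfolding v_elem_def star_sum star_mult using h x hc
    by (intro sum.cong) (simp_all add: star_delta star_rho half_ints_shift conj_closed inv_conj)
  also have "\<dots> = (\<Sum>k\<in>carrier G. F (k \<otimes> inv h))"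
  proof (rule sum.cong)
    fix k assume k: "k \<in> carrier G"
    let ?a = "k \<otimes> h \<otimes> inv k" and ?b = "k \<otimes> inv h \<otimes> inv k"
    have mem: "?a \<in> H" "?b \<in> H" using h k by (simp_all add: conj_closed)
    have ak: "?a \<otimes> (k \<otimes> inv h) = k" using k hc by (simp add: m_assoc cancel)
    have bab: "inv ?a \<otimes> ?b \<otimes> ?a = ?b"
      using k hc by (simp add: inv_mult_group m_assoc cancel)
    have conj: "k \<otimes> inv h \<otimes> h \<otimes> inv (k \<otimes> inv h) = ?a"
      "k \<otimes> inv h \<otimes> inv h \<otimes> inv (k \<otimes> inv h) = ?b"
      using k hc by (simp_all add: m_assoc inv_mult_group cancel)
    have "\<rho> ?b ?r * (\<delta> k x * \<rho> ?a ?l) = \<rho> ?b ?r * (\<rho> ?a ?l * \<delta> (k \<otimes> inv h) x)"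
      using rho_delta_left[of ?a "k \<otimes> inv h" ?l x] ak mem k hc x by (simp add: half_ints_shift)
    also have "\<dots> = \<rho> ?a ?l * (\<rho> ?b ?r * \<delta> (k \<otimes> inv h) x)"
      using rho_rho[of ?b ?a ?r ?l] bab mem x
      by (simp add: half_ints_shift mult.assoc[symmetric])
    also have "\<dots> = F (k \<otimes> inv h)"
      using rho_delta_right[of ?b "k \<otimes> inv h" ?r x] mem k hc x
      by (simp add: F_def half_ints_shift conj mult.assoc)
    finally show "\<rho> ?b ?r * (\<delta> k x * \<rho> ?a ?l) = F (k \<otimes> inv h)" .
  qed simp
  also have "\<dots> = (\<Sum>k\<in>carrier G. F k)"
    using hc by (simp add: sum_carrier_right_mult)
  also have "\<dots> = v (inv h) x" using hc by (simp add: v_elem_def F_def)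
  finally show ?thesis .
qed

section \<open>The generated algebra consists of observables\<close>

abbreviation \<B> where "\<B> \<equiv> generated_cstar_subalgebra
  ({v h x | h x. h \<in> H \<and> x \<in> \<int>} \<union> {w g l | g l. g \<in> carrier G \<and> l \<in> half_ints})"

lemma v_in_\<B>: "h \<in> H \<Longrightarrow> x \<in> \<int> \<Longrightarrow> v h x \<in> \<B>"
  and w_in_\<B>: "g \<in> carrier G \<Longrightarrow> l \<in> half_ints \<Longrightarrow> w g l \<in> \<B>"
  by (rule subsetD[OF generated_cstar_subalgebra_superset], blast)+

lemmas \<B>_closed = cstar_subalgebraD[OF cstar_subalgebra_generated]
  cstar_subalgebra_zero[OF cstar_subalgebra_generated]
  cstar_subalgebra_sum[OF cstar_subalgebra_generated]

lemma \<B>_subset_observable: "\<B> \<subseteq> \<O>"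
proof -
  have "\<B> \<subseteq> {F \<in> \<O>. star F \<in> \<O>}"
    by (rule generated_cstar_subalgebra_minimal[OF _ cstar_subalgebra_observable_star])
      (auto simp: v_observable w_observable star_v star_w)
  then show ?thesis by blast
qed


section \<open>Localising observables at a site\<close>

text \<open>Agreement with an element of \<B> on the corner cut out by the projection
  \<open>\<delta> k x0\<close>. Both commutation conditions are built in so that the property passes
  to products.\<close>

definition localised :: "'g \<Rightarrow> rat \<Rightarrow> 'a set" where
  "localised k x0 = {F. F * \<delta> k x0 = \<delta> k x0 * F \<and>
     (\<exists>A\<in>\<B>. A * \<delta> k x0 = \<delta> k x0 * A \<and> F * \<delta> k x0 = A * \<delta> k x0)}"

lemma localised_\<B>: "A \<in> \<B> \<Longrightarrow> A * \<delta> k x0 = \<delta> k x0 * A \<Longrightarrow> A \<in> localised k x0"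
  by (auto simp: localised_def)

lemma localisedE:
  assumes "F \<in> localised k x0"
  obtains A where "F * \<delta> k x0 = \<delta> k x0 * F" "A \<in> \<B>" "A * \<delta> k x0 = \<delta> k x0 * A"
    "F * \<delta> k x0 = A * \<delta> k x0"
  using assms unfolding localised_def by blast

lemma localisedI:
  "F * \<delta> k x0 = \<delta> k x0 * F \<Longrightarrow> A \<in> \<B> \<Longrightarrow> A * \<delta> k x0 = \<delta> k x0 * A \<Longrightarrow>
    F * \<delta> k x0 = A * \<delta> k x0 \<Longrightarrow> F \<in> localised k x0"
  unfolding localised_def by blast

lemma localised_add:
  assumes "F \<in> localised k x0" "F' \<in> localised k x0"
  shows "F + F' \<in> localised k x0"
proof -
  obtain A where A: "F * \<delta> k x0 = \<delta> k x0 * F" "A \<in> \<B>" "A * \<delta> k x0 = \<delta> k x0 * A"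
    "F * \<delta> k x0 = A * \<delta> k x0"
    using assms(1) by (rule localisedE)
  obtain A' where A': "F' * \<delta> k x0 = \<delta> k x0 * F'" "A' \<in> \<B>" "A' * \<delta> k x0 = \<delta> k x0 * A'"
    "F' * \<delta> k x0 = A' * \<delta> k x0"
    using assms(2) by (rule localisedE)
  show ?thesis
  proof (rule localisedI)
    show "A + A' \<in> \<B>" using A(2) A'(2) by (rule \<B>_closed(2))
    show "(F + F') * \<delta> k x0 = \<delta> k x0 * (F + F')"
      unfolding distrib_left distrib_right A(1) A'(1) ..
    show "(A + A') * \<delta> k x0 = \<delta> k x0 * (A + A')"
      unfolding distrib_left distrib_right A(3) A'(3) ..
    show "(F + F') * \<delta> k x0 = (A + A') * \<delta> k x0"
      unfolding distrib_left distrib_right A(4) A'(4) ..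
  qed
qed

lemma localised_zero: "0 \<in> localised k x0"
  by (simp add: localised_\<B> \<B>_closed)

lemma localised_one: "1 \<in> localised k x0"
  by (simp add: localised_\<B> \<B>_closed)

lemma localised_sum:
  "(\<And>i. i \<in> A \<Longrightarrow> F i \<in> localised k x0) \<Longrightarrow> (\<Sum>i\<in>A. F i) \<in> localised k x0"
  by (induction A rule: infinite_finite_induct) (simp_all add: localised_zero localised_add)

lemma localised_mult:
  assumes "F \<in> localised k x0" "F' \<in> localised k x0"
  shows "F * F' \<in> localised k x0"
proof -
  let ?D = "\<delta> k x0"
  obtain A where A: "F * ?D = ?D * F" "A \<in> \<B>" "A * ?D = ?D * A" "F * ?D = A * ?D"
    using assms(1) by (rule localisedE)
  obtain A' where A': "F' * ?D = ?D * F'" "A' \<in> \<B>" "A' * ?D = ?D * A'" "F' * ?D = A' * ?D"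
    using assms(2) by (rule localisedE)
  \<comment> \<open>After \<open>F'\<close> is replaced by \<open>A'\<close>, the projection is
    pulled through \<open>A'\<close> to stand next to \<open>F\<close>, and is pushed back once
    \<open>F\<close> has become \<open>A\<close>.\<close>
  have "F * F' * ?D = F * ?D * A'" by (simp only: mult.assoc A'(4) A'(3))
  also have "\<dots> = A * A' * ?D" by (simp only: A(4)) (simp only: mult.assoc A'(3))
  finally have "F * F' * ?D = A * A' * ?D" .
  with mult_commutes[OF A(1) A'(1)] \<B>_closed(4)[OF A(2) A'(2)] mult_commutes[OF A(3) A'(3)]
  show ?thesis by (rule localisedI)
qed

text \<open>Induction on the distance from \<open>x0\<close>. At \<open>x0\<close> the corner turns
  the projection into 1 or 0; afterwards a suitable \<open>w\<close> carries the value
  \<open>a\<close> at \<open>x\<close> to the value \<open>f\<close> at \<open>x + 1\<close>, and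
  the partition of unity at \<open>x\<close> sums over all \<open>a\<close>.\<close>

lemma localised_delta:
  assumes "k \<in> carrier G" "x0 \<in> \<int>" "f \<in> carrier G"
  shows "\<delta> f (x0 + of_nat n) \<in> localised k x0"
  using assms(3)
proof (induction n arbitrary: f)
  case 0
  have "\<delta> f x0 * \<delta> k x0 = (if f = k then 1 else 0) * \<delta> k x0"
    using assms 0 by (simp add: delta_mult)
  moreover have "\<delta> f x0 * \<delta> k x0 = \<delta> k x0 * \<delta> f x0"
    using assms 0 by (intro delta_commute)
  ultimately show ?case
    by (intro localisedI[where A = "if f = k then 1 else 0"]) (auto simp: \<B>_closed)
next
  case (Suc n)
  define x where "x = x0 + of_nat n"
  have x: "x \<in> \<int>" "x + 1 \<in> \<int>" using assms by (simp_all add: x_def)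
  have shift: "x + 1/2 - 1/2 = x" "x + 1/2 + 1/2 = x + 1" by simp_all
  \<comment> \<open>Only the summand \<open>c = a\<close> survives, and its second factor carries
    the label \<open>a \<otimes> (inv a \<otimes> f) = f\<close>.\<close>
  have w_mult: "w (inv a \<otimes> f) (x + 1/2) * \<delta> a x = \<delta> a x * \<delta> f (x + 1)"
    if a: "a \<in> carrier G" for a
  proof -
    have "w (inv a \<otimes> f) (x + 1/2) * \<delta> a x =
        (\<Sum>c\<in>carrier G. if c = a then \<delta> a x * \<delta> f (x + 1) else 0)"
      unfolding w_elem_def sum_distrib_right shift
    proof (rule sum.cong)
      fix c assume c: "c \<in> carrier G"
      have "\<delta> c x * \<delta> (c \<otimes> (inv a \<otimes> f)) (x + 1) * \<delta> a x =
          \<delta> c x * \<delta> a x * \<delta> (c \<otimes> (inv a \<otimes> f)) (x + 1)"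
        using a c x Suc.prems delta_commute[of "c \<otimes> (inv a \<otimes> f)" a "x + 1" x]
        by (simp add: mult.assoc)
      then show "\<delta> c x * \<delta> (c \<otimes> (inv a \<otimes> f)) (x + 1) * \<delta> a x =
          (if c = a then \<delta> a x * \<delta> f (x + 1) else 0)"
        using a c x Suc.prems by (simp add: delta_mult cancel)
    qed simp
    also have "\<dots> = \<delta> a x * \<delta> f (x + 1)" using a by (simp add: sum.delta)
    finally show ?thesis .
  qed
  have "\<delta> f (x + 1) = (\<Sum>a\<in>carrier G. \<delta> a x * \<delta> f (x + 1))"
    using sum_delta[OF x(1)] by (simp add: sum_distrib_right[symmetric])
  also have "\<dots> = (\<Sum>a\<in>carrier G. w (inv a \<otimes> f) (x + 1/2) * \<delta> a x)"
    using w_mult by simp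
  also have "\<dots> \<in> localised k x0"
  proof (rule localised_sum, rule localised_mult)
    fix a assume a: "a \<in> carrier G"
    show "\<delta> a x \<in> localised k x0" using Suc.IH[OF a] by (simp add: x_def)
    have "w (inv a \<otimes> f) (x + 1/2) \<in> \<B>"
      using a Suc.prems x by (intro w_in_\<B>) (auto simp: half_ints_shift)
    moreover have "w (inv a \<otimes> f) (x + 1/2) * \<delta> k x0 = \<delta> k x0 * w (inv a \<otimes> f) (x + 1/2)"
      unfolding w_elem_def sum_distrib_left sum_distrib_right shift
    proof (rule sum.cong)
      fix c assume c: "c \<in> carrier G"
      show "\<delta> c x * \<delta> (c \<otimes> (inv a \<otimes> f)) (x + 1) * \<delta> k x0 =
          \<delta> k x0 * (\<delta> c x * \<delta> (c \<otimes> (inv a \<otimes> f)) (x + 1))"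
        using a c x Suc.prems assms by (intro mult_commutes delta_commute) auto
    qed simp
    ultimately show "w (inv a \<otimes> f) (x + 1/2) \<in> localised k x0" by (rule localised_\<B>)
  qed
  finally show ?case by (simp add: x_def algebra_simps)
qed

text \<open>Multiplying \<open>v\<close> by \<open>\<delta> j x\<close> leaves the single term at
  \<open>j\<close>. The label \<open>inv j \<otimes> inv h \<otimes> j\<close> undoes the
  conjugation in that term, and the partition of unity at \<open>x\<close> expresses the pair
  through such products.\<close>

lemma localised_rho_pair:
  assumes k: "k \<in> carrier G" and x0: "x0 \<in> \<int>" and h: "h \<in> H" and x: "x \<in> \<int>" "x0 < x"
  shows "\<rho> h (x - 1/2) * \<rho> (inv h) (x + 1/2) \<in> localised k x0"
proof -
  let ?l = "x - 1/2" and ?r = "x + 1/2"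
  have hc: "h \<in> carrier G" using h by (rule mem_carrier)
  have sites: "?l \<in> half_ints" "?r \<in> half_ints" using x by (simp_all add: half_ints_shift)
  obtain n where n: "x = x0 + of_nat n"
    using Ints_diff_of_nat[of x x0] x x0 by auto
  \<comment> \<open>The integer sites differ by at least 1, so even \<open>x - 1/2\<close> lies to
    the right of \<open>x0\<close>; hence both charges commute with
    \<open>\<delta> k x0\<close>.\<close>
  have x0_less: "x0 < ?l" "x0 < ?r"
  proof -
    have "n \<noteq> 0" using n x by auto
    then have "(1::rat) \<le> of_nat n" by simp
    then show "x0 < ?l" "x0 < ?r" using n by linarith+
  qed
  have v_mult: "v (inv j \<otimes> inv h \<otimes> j) x * \<delta> j x = \<rho> h ?l * \<rho> (inv h) ?r * \<delta> j x"
    if j: "j \<in> carrier G" for j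
  proof -
    let ?t = "inv j \<otimes> inv h \<otimes> j"
    have t: "?t \<in> H" "inv ?t \<in> H" using h j by (simp_all add: conj_inv_closed)
    have tj: "j \<otimes> ?t \<otimes> inv j = inv h" "j \<otimes> inv ?t \<otimes> inv j = h"
    proof -
      show *: "j \<otimes> ?t \<otimes> inv j = inv h"
        using j hc by (simp add: m_assoc cancel)
      show "j \<otimes> inv ?t \<otimes> inv j = h"
        using inv_conj[of j ?t] * j hc by simp
    qed
    have "v ?t x * \<delta> j x = (\<Sum>c\<in>carrier G. if c = j then \<rho> h ?l * \<rho> (inv h) ?r * \<delta> j x else 0)"
      unfolding v_elem_def sum_distrib_right
    proof (rule sum.cong)
      fix c assume c: "c \<in> carrier G"
      have mem: "c \<otimes> inv ?t \<otimes> inv c \<in> H" "c \<otimes> ?t \<otimes> inv c \<in> H"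
        using t c by (simp_all add: conj_closed)
      \<comment> \<open>The right charge sits to the right of \<open>x\<close>, so
        \<open>\<delta> j x\<close> passes it freely and meets \<open>\<delta> c x\<close>.\<close>
      have "\<rho> (c \<otimes> inv ?t \<otimes> inv c) ?l * \<delta> c x * \<rho> (c \<otimes> ?t \<otimes> inv c) ?r * \<delta> j x =
          \<rho> (c \<otimes> inv ?t \<otimes> inv c) ?l * (\<delta> c x * \<delta> j x) * \<rho> (c \<otimes> ?t \<otimes> inv c) ?r"
        using mem j x sites by (simp add: mult.assoc rho_delta_right)
      also have "\<dots> = (if c = j then \<rho> h ?l * \<rho> (inv h) ?r * \<delta> j x else 0)"
        using j c x tj rho_delta_right[of "inv h" j ?r x] h sites
        by (simp add: delta_mult mult.assoc)
      finally show "\<rho> (c \<otimes> inv ?t \<otimes> inv c) ?l * \<delta> c x * \<rho> (c \<otimes> ?t \<otimes> inv c) ?r * \<delta> j x = \<dots>" .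
    qed simp
    also have "\<dots> = \<rho> h ?l * \<rho> (inv h) ?r * \<delta> j x" using j by (simp add: sum.delta)
    finally show ?thesis .
  qed
  have "\<rho> h ?l * \<rho> (inv h) ?r = (\<Sum>j\<in>carrier G. \<rho> h ?l * \<rho> (inv h) ?r * \<delta> j x)"
    using sum_delta[OF x(1)] by (simp add: sum_distrib_left[symmetric])
  also have "\<dots> = (\<Sum>j\<in>carrier G. v (inv j \<otimes> inv h \<otimes> j) x * \<delta> j x)"
    using v_mult by simp
  also have "\<dots> \<in> localised k x0"
  proof (rule localised_sum, rule localised_mult)
    fix j assume j: "j \<in> carrier G"
    let ?t = "inv j \<otimes> inv h \<otimes> j"
    have t: "?t \<in> H" "inv ?t \<in> H" using h j by (simp_all add: conj_inv_closed)
    show "\<delta> j x \<in> localised k x0" using localised_delta[OF k x0 j] by (simp add: n)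
    have "v ?t x \<in> \<B>" using t x by (intro v_in_\<B>)
    moreover have "v ?t x * \<delta> k x0 = \<delta> k x0 * v ?t x"
      unfolding v_elem_def sum_distrib_left sum_distrib_right
    proof (rule sum.cong)
      fix c assume c: "c \<in> carrier G"
      have mem: "c \<otimes> inv ?t \<otimes> inv c \<in> H" "c \<otimes> ?t \<otimes> inv c \<in> H"
        using t c by (simp_all add: conj_closed)
      have "\<rho> (c \<otimes> inv ?t \<otimes> inv c) ?l * \<delta> k x0 = \<delta> k x0 * \<rho> (c \<otimes> inv ?t \<otimes> inv c) ?l"
        "\<rho> (c \<otimes> ?t \<otimes> inv c) ?r * \<delta> k x0 = \<delta> k x0 * \<rho> (c \<otimes> ?t \<otimes> inv c) ?r"
        "\<delta> c x * \<delta> k x0 = \<delta> k x0 * \<delta> c x"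
        using rho_delta_right[OF mem(1) k sites(1) x0 x0_less(1)]
          rho_delta_right[OF mem(2) k sites(2) x0 x0_less(2)] delta_commute[OF c k x(1) x0]
        by simp_all
      then show "\<rho> (c \<otimes> inv ?t \<otimes> inv c) ?l * \<delta> c x * \<rho> (c \<otimes> ?t \<otimes> inv c) ?r * \<delta> k x0 =
          \<delta> k x0 * (\<rho> (c \<otimes> inv ?t \<otimes> inv c) ?l * \<delta> c x * \<rho> (c \<otimes> ?t \<otimes> inv c) ?r)"
        by (intro mult_commutes)
    qed simp
    ultimately show "v ?t x \<in> localised k x0" by (rule localised_\<B>)
  qed
  finally show ?thesis .
qed

text \<open>Telescoping: in a product of neighbouring pairs the inner charges \<open>inv h\<close>
  and \<open>h\<close> meet at one site and cancel.\<close>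

lemma localised_rho_string:
  assumes k: "k \<in> carrier G" and x0: "x0 \<in> \<int>" and h: "h \<in> H" and l: "l \<in> half_ints" "x0 < l"
  shows "\<rho> h l * \<rho> (inv h) (l + of_nat n) \<in> localised k x0"
proof (induction n)
  case 0
  show ?case using h l by (simp add: rho_mult rho_one localised_one mem_carrier)
next
  case (Suc n)
  let ?l = "l + of_nat n"
  have half: "?l \<in> half_ints" using l by (simp add: half_ints_shift)
  have "?l + 1/2 \<in> \<int>" using half by (rule half_ints_shift)
  moreover have "x0 < ?l + 1/2" using l of_nat_0_le_iff[of n, where 'a = rat] by linarith
  ultimately have "\<rho> h ?l * \<rho> (inv h) (?l + 1) \<in> localised k x0"
    using localised_rho_pair[OF k x0 h, of "?l + 1/2"] by (simp add: add.assoc)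
  with Suc have
    "(\<rho> h l * \<rho> (inv h) ?l) * (\<rho> h ?l * \<rho> (inv h) (?l + 1)) \<in> localised k x0"
    by (rule localised_mult)
  also have "(\<rho> h l * \<rho> (inv h) ?l) * (\<rho> h ?l * \<rho> (inv h) (?l + 1)) =
      \<rho> h l * (\<rho> (inv h) ?l * \<rho> h ?l) * \<rho> (inv h) (?l + 1)"
    by (simp add: mult.assoc)
  also have "\<rho> (inv h) ?l * \<rho> h ?l = 1"
    using h half by (simp add: rho_mult rho_one mem_carrier)
  finally show ?case by (simp add: algebra_simps)
qed


section \<open>Averaging monomials\<close>

abbreviation monomial :: "'g gen list \<Rightarrow> 'a" where
  "monomial ys \<equiv> prod_list (map (case_gen \<delta> \<rho>) ys)"

text \<open>Each factor \<open>\<rho>\<^sub>h(l)\<close> is neutralised by transporting its charge \<open>h\<close> to a site \<open>L\<close> to the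
  right of the whole monomial, where the charges collect to a single \<open>\<rho>\<close>.\<close>

lemma monomial_localised:
  assumes "x0 \<in> \<int>" "L \<in> half_ints" "set ys \<subseteq> field_gens G H"
    and "\<And>y. y \<in> set ys \<Longrightarrow> x0 < gen_site y \<and> gen_site y < L"
  shows "\<exists>d\<in>H. (\<exists>\<Phi>. homogeneous d (monomial ys) \<Phi>) \<and>
    (\<forall>k\<in>carrier G. monomial ys * \<rho> (inv d) L \<in> localised k x0)"
  using assms(3,4)
\<comment> \<open>New letters are appended at the right end, where the compensating charge
  stands.\<close>
proof (induction ys rule: rev_induct)
  case Nil
  show ?case
    using homogeneous_one assms(2) by (intro bexI[of _ \<one>]) (auto simp: rho_one localised_one)
next
  case (snoc y ys)
  then obtain d \<Phi> where d: "d \<in> H" "homogeneous d (monomial ys) \<Phi>"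
    and loc: "\<And>k. k \<in> carrier G \<Longrightarrow> monomial ys * \<rho> (inv d) L \<in> localised k x0"
    by (auto simp: in_mono)
  have dc: "d \<in> carrier G" using d(1) by (rule mem_carrier)
  have site: "x0 < gen_site y" "gen_site y < L" using snoc.prems by auto
  from snoc.prems have "y \<in> field_gens G H" by simp
  then consider (Delta) g x where "y = Delta g x" "g \<in> carrier G" "x \<in> \<int>"
    | (Rho) h l where "y = Rho h l" "h \<in> H" "l \<in> half_ints"
    by (auto simp: field_gens_def)
  then show ?case
  proof cases
    case Delta
    obtain n where n: "x = x0 + of_nat n"
      using Ints_diff_of_nat[of x x0] Delta site assms(1) by auto
    \<comment> \<open>\<open>L\<close> lies to the right of \<open>x\<close>, so the collected
      charge commutes with \<open>\<delta> g x\<close>.\<close>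
    have "monomial (ys @ [y]) * \<rho> (inv d) L = monomial ys * \<rho> (inv d) L * \<delta> g x"
      using Delta d site assms(2) rho_delta_right[of "inv d" g L x] by (simp add: mult.assoc)
    moreover have "monomial ys * \<rho> (inv d) L * \<delta> g x \<in> localised k x0" if "k \<in> carrier G" for k
      using loc[OF that] localised_delta[OF that assms(1) Delta(2)] unfolding n
      by (rule localised_mult)
    moreover have "\<exists>\<Phi>. homogeneous d (monomial (ys @ [y])) \<Phi>"
      using homogeneous_mult[OF d(2) homogeneous_delta[OF Delta(2,3)] d(1)] dc Delta(1) by auto
    ultimately show ?thesis using d(1) by (intro bexI[of _ d]) simp_all
  next
    case Rho
    have hc: "h \<in> carrier G" using Rho(2) by (rule mem_carrier)
    obtain n where n: "L = l + of_nat n"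
      using Ints_diff_of_nat[of L l] half_ints_diff[of l L] Rho site assms(2) by auto
    have c: "inv h \<otimes> inv d \<otimes> h \<in> H" using hc d by (simp add: conj_inv_closed)
    \<comment> \<open>Passing \<open>\<rho> h l\<close> conjugates the collected charge by
      \<open>h\<close>; multiplied by the new \<open>inv h\<close> at \<open>L\<close> it becomes
      the inverse of the new degree \<open>d \<otimes> h\<close>.\<close>
    have "monomial ys * \<rho> (inv d) L * (\<rho> h l * \<rho> (inv h) L) =
        monomial ys * \<rho> h l * (\<rho> (inv h \<otimes> inv d \<otimes> h) L * \<rho> (inv h) L)"
      using Rho d site assms(2) rho_rho[of "inv d" h L l]
      by (simp add: mult.assoc) (simp add: mult.assoc[symmetric])
    also have "\<rho> (inv h \<otimes> inv d \<otimes> h) L * \<rho> (inv h) L = \<rho> (inv (d \<otimes> h)) L"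
      using c Rho assms(2) hc dc by (simp add: rho_mult m_assoc inv_mult_group cancel)
    finally have "monomial (ys @ [y]) * \<rho> (inv (d \<otimes> h)) L =
        monomial ys * \<rho> (inv d) L * (\<rho> h l * \<rho> (inv h) L)"
      using Rho by simp
    moreover have "monomial ys * \<rho> (inv d) L * (\<rho> h l * \<rho> (inv h) L) \<in> localised k x0"
      if "k \<in> carrier G" for k
      using loc[OF that] localised_rho_string[OF that assms(1) Rho(2,3), of n] site Rho(1)
      unfolding n by (intro localised_mult[of "monomial ys * _"]) simp_all
    moreover have "\<exists>\<Phi>. homogeneous (d \<otimes> h) (monomial (ys @ [y])) \<Phi>"
      using homogeneous_mult[OF d(2) homogeneous_rho[OF Rho(2,3)] d(1) Rho(2)] Rho(1) by auto
    ultimately show ?thesis using d(1) Rho(2) by (intro bexI[of _ "d \<otimes> h"]) simp_all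
  qed
qed

lemma average_monomial:
  assumes "set ys \<subseteq> field_gens G H"
  shows "(\<Sum>g\<in>carrier G. act_basis \<one> g (monomial ys)) \<in> \<B>"
proof -
  obtain n :: nat where n: "\<And>y. y \<in> set ys \<Longrightarrow> \<bar>gen_site y\<bar> < of_nat n"
    using word_sites_bounded by blast
  define x0 :: rat where "x0 = - of_nat n"
  define L :: rat where "L = of_nat n + 1/2"
  have x0: "x0 \<in> \<int>" and L: "L \<in> half_ints" by (simp_all add: x0_def L_def half_ints_def)
  have "x0 < gen_site y \<and> gen_site y < L" if "y \<in> set ys" for y
    using n[OF that] by (auto simp: x0_def L_def abs_less_iff)
  from monomial_localised[OF x0 L assms this] obtain d \<Phi> where d: "d \<in> H"
    "homogeneous d (monomial ys) \<Phi>"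
    "\<And>k. k \<in> carrier G \<Longrightarrow> monomial ys * \<rho> (inv d) L \<in> localised k x0"
    by blast
  show ?thesis
  proof (cases "d = \<one>")
    case False
    \<comment> \<open>\<open>act_basis \<one> g\<close> sees only degree \<open>\<one>\<close>, and
      no conjugate of a nontrivial \<open>d\<close> is trivial.\<close>
    have "act_basis \<one> g (monomial ys) = 0" if g: "g \<in> carrier G" for g
    proof -
      have "\<one> \<noteq> g \<otimes> d \<otimes> inv g"
      proof
        assume "\<one> = g \<otimes> d \<otimes> inv g"
        then have "g \<otimes> d = g" using g d(1) mem_carrier[OF d(1)]
          by (metis inv_solve_right l_one m_closed one_closed)
        with False g mem_carrier[OF d(1)] show False by simp
      qed
      with d(2) g show ?thesis by (simp add: homogeneous_def)
    qed
    then show ?thesis by (simp add: \<B>_closed)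
  next
    case True
    \<comment> \<open>For trivial degree the compensating charge is
      \<open>\<rho> \<one> L = 1\<close>, so the monomial itself is localised.\<close>
    have "\<forall>k\<in>carrier G. \<exists>A. A \<in> \<B> \<and> monomial ys * \<delta> k x0 = A * \<delta> k x0"
      using d(3) L True by (auto simp: rho_one elim: localisedE)
    from bchoice[OF this] obtain A where A: "\<And>k. k \<in> carrier G \<Longrightarrow> A k \<in> \<B>"
      "\<And>k. k \<in> carrier G \<Longrightarrow> monomial ys * \<delta> k x0 = A k * \<delta> k x0"
      by blast
    \<comment> \<open>The element \<open>A k\<close> of \<B> is an observable, so only the
      projection is moved.\<close>
    have act_A: "act_basis \<one> g (A k * \<delta> k x0) = A k * \<delta> (g \<otimes> k) x0"
      if "g \<in> carrier G" "k \<in> carrier G" for g k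
    proof -
      have "homogeneous \<one> (A k) (\<lambda>g. A k)"
        using A(1)[OF that(2)] \<B>_subset_observable observable_iff_homogeneous by blast
      from homogeneous_mult[OF this homogeneous_delta[OF that(2) x0]] that
      show ?thesis by (simp add: homogeneous_def)
    qed
    have "monomial ys = (\<Sum>k\<in>carrier G. monomial ys * \<delta> k x0)"
      by (simp add: sum_distrib_left[symmetric] sum_delta[OF x0])
    also have "\<dots> = (\<Sum>k\<in>carrier G. A k * \<delta> k x0)" using A(2) by simp
    finally have "(\<Sum>g\<in>carrier G. act_basis \<one> g (monomial ys)) =
        (\<Sum>g\<in>carrier G. \<Sum>k\<in>carrier G. A k * \<delta> (g \<otimes> k) x0)"
      by (simp add: act_sum double_basis_carrier act_A)
    also have "\<dots> = (\<Sum>k\<in>carrier G. A k * (\<Sum>g\<in>carrier G. \<delta> (g \<otimes> k) x0))"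
      by (subst sum.swap) (simp add: sum_distrib_left)
    also have "\<dots> = (\<Sum>k\<in>carrier G. A k)"
      using sum_delta[OF x0] by (simp add: sum_carrier_right_mult[where F = "\<lambda>k. \<delta> k x0"])
    finally show ?thesis using A(1) by (simp add: \<B>_closed)
  qed
qed

section \<open>From monomials to all observables by linearity and density\<close>

lemma average_local:
  assumes "p \<in> free_algebra (field_gens G H)"
  shows "(\<Sum>g\<in>carrier G. act_basis \<one> g (free_eval (case_gen \<delta> \<rho>) p)) \<in> \<B>"
proof -
  have "(\<Sum>g\<in>carrier G. act_basis \<one> g (free_eval (case_gen \<delta> \<rho>) p)) =
      (\<Sum>g\<in>carrier G. \<Sum>u\<in>Poly_Mapping.keys p.
        Poly_Mapping.lookup p u *\<^sub>C act_basis \<one> g (monomial (letters u)))"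
    by (simp add: free_eval_def act_sum act_scaleC double_basis_carrier)
  also have "\<dots> = (\<Sum>u\<in>Poly_Mapping.keys p. Poly_Mapping.lookup p u *\<^sub>C
      (\<Sum>g\<in>carrier G. act_basis \<one> g (monomial (letters u))))"
    by (subst sum.swap) (simp add: scaleC_sum_right)
  also have "\<dots> \<in> \<B>"
    using assms by (intro \<B>_closed(8) \<B>_closed(3) average_monomial) (auto simp: free_algebra_def)
  finally show ?thesis .
qed

text \<open>The unnormalised average \<open>?E\<close> is continuous and maps a dense set into the
  closed set \<B>, hence maps everything there. On an observable it is multiplication by the order
  of \<open>G\<close>, which is nonzero and can be divided out.\<close>

lemma observable_subset_\<B>: "\<O> \<subseteq> \<B>"
proof
  fix F assume F: "F \<in> \<O>"
  let ?E = "\<lambda>F. \<Sum>g\<in>carrier G. act_basis \<one> g F"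
  let ?loc = "free_eval (case_gen \<delta> \<rho>) ` free_algebra (field_gens G H)"
  have "?E ` closure ?loc \<subseteq> \<B>"
  proof (rule image_closure_subset)
    show "continuous_on (closure ?loc) ?E"
      by (intro continuous_on_sum continuous_on_subset[OF continuous_act] double_basis_carrier)
        auto
  qed (auto simp: \<B>_closed average_local)
  then have "?E F \<in> \<B>"
    using field_algebra by (auto simp: is_field_algebra_def)
  moreover have "?E F = of_nat (card (carrier G)) *\<^sub>C F"
  proof -
    have "?E F = (\<Sum>g\<in>carrier G. 1 *\<^sub>C F)"
      using F by (intro sum.cong) (auto simp: observable_iff_homogeneous homogeneous_def)
    also have "\<dots> = of_nat (card (carrier G)) *\<^sub>C F"
      unfolding scaleC_sum_left[symmetric] by simp
    finally show ?thesis .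
  qed
  ultimately have
    "(1 / of_nat (card (carrier G))) *\<^sub>C of_nat (card (carrier G)) *\<^sub>C F \<in> \<B>"
    by (simp add: \<B>_closed)
  moreover have "card (carrier G) \<noteq> 0" using one_closed by (auto simp: card_eq_0_iff)
  ultimately show "F \<in> \<B>" by (simp add: scaleC_scaleC)
qed

end

theorem theorem2p1:
  fixes G :: "('g, 'm) monoid_scheme"
    and H :: "'g set"
    and \<delta> \<rho> :: "'g \<Rightarrow> rat \<Rightarrow> 'a::unital_cstar_algebra"
    and act :: "('g \<times> 'g \<Rightarrow> complex) \<Rightarrow> 'a \<Rightarrow> 'a"
  assumes "group G" and "finite (carrier G)" and "H \<lhd> G"
    and "is_field_algebra G H \<delta> \<rho>"
    and "is_field_action G H \<delta> \<rho> act"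
  shows "observable_algebra G H act =
    generated_cstar_subalgebra
      ({v_elem G \<delta> \<rho> h x | h x. h \<in> H \<and> x \<in> \<int>} \<union>
       {w_elem G \<delta> g l | g l. g \<in> carrier G \<and> l \<in> half_ints})"
proof -
  interpret field_system H G \<delta> \<rho> act
    using assms by (simp add: field_system_def field_system_axioms_def)
  show ?thesis using observable_subset_\<B> \<B>_subset_observable by (rule equalityI)
qed

end
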